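(* Let the coupling graph be the cycle $C_N$ on $n=N$ vertices ($N\ge3$), and let $\Gamma=(Q,C)$ be a quantum circuit on $n$ qubits. Let $c$ be the number of qubits that lie in a connected component of size at least 3 of the gate graph of $\Gamma$. If $c\ge3$, then $B_\tau$ is trivial for all $\tau\in\mathbb{S}_n$.
   Context: Notation: $[n]=\{1,\dots,n\}$; $\mathbb{S}_n$ is the symmetric group on $[n]$; $\tau^{-1}(S)=\{\tau^{-1}(s):s\in S\}$. $C_N$ is the graph with vertex set $[N]$ and edge set $E=\{\{i,i+1\}:i\in[N-1]\}\cup\{\{N,1\}\}$; $\mathrm{Aut}(C_N)$ is its automorphism group. Qubits $Q=\{q_1,\dots,q_n\}$ are identified with $[n]$; a gate is a two-element subset of $Q$; a quantum circuit is $\Gamma=(Q,C)$ with $C$ a finite sequence of gates. The gate graph $(Q,U)$ is the undirected graph with vertex set $Q$ and edge set $U=\{g:g\in C\}$. The fixing pattern $\mathcal{F}=\{S_1,\dots,S_l\}$ is the partition of $Q$ whose parts are: each singleton consisting of a qubit in a connected component of $(Q,U)$ of size at least 3; each pair of qubits forming a connected component of size 2; and the set of all isolated vertices of $(Q,U)$ (if nonempty). For $\tau\in\mathbb{S}_n$ (a bijection from locations $[n]$ to qubits $Q$), $B_\tau=\{b\in\mathrm{Aut}(C_N):b(\tau^{-1}(S_i))=\tau^{-1}(S_i)\ \forall i\in[l]\}$. *)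

theory Defs
  imports "HOL-Combinatorics.Permutations"
begin

section \<open>Undirected graphs\<close>

record 'a ugraph =
  vertices :: "'a set"
  edges :: "'a set set"

definition reach_rel :: "'a ugraph \<Rightarrow> 'a rel" where
  "reach_rel G = {(u, v) \<in> vertices G \<times> vertices G. (u, v) \<in> {(x, y). {x, y} \<in> edges G}\<^sup>*}"

definition conn_comps :: "'a ugraph \<Rightarrow> 'a set set" where
  "conn_comps G = vertices G // reach_rel G"

definition isolated_verts :: "'a ugraph \<Rightarrow> 'a set" where
  "isolated_verts G = {v \<in> vertices G. \<forall>e \<in> edges G. v \<notin> e}"

text \<open>An automorphism is extended by the identity outside the vertex set (this is part of
  \<open>permutes\<close>), so that distinct elements differ on the vertex set and the trivial subgroup
  is \<open>{id}\<close>.\<close>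

definition graph_aut :: "'a ugraph \<Rightarrow> ('a \<Rightarrow> 'a) set" where
  "graph_aut G = {b. b permutes vertices G \<and>
     (\<forall>u \<in> vertices G. \<forall>v \<in> vertices G. {b u, b v} \<in> edges G \<longleftrightarrow> {u, v} \<in> edges G)}"

definition cycle_graph :: "nat \<Rightarrow> nat ugraph" where
  "cycle_graph N = \<lparr>vertices = {1..N}, edges = {{i, i + 1} | i. i \<in> {1..N - 1}} \<union> {{N, 1}}\<rparr>"


section \<open>Quantum circuits\<close>

record circuit =
  qubits :: "nat set"
  gates :: "nat set list"

definition quantum_circuit :: "nat \<Rightarrow> circuit \<Rightarrow> bool" where
  "quantum_circuit n \<Gamma> \<longleftrightarrow>
     qubits \<Gamma> = {1..n} \<and> (\<forall>g \<in> set (gates \<Gamma>). g \<subseteq> qubits \<Gamma> \<and> card g = 2)"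

definition gate_graph :: "circuit \<Rightarrow> nat ugraph" where
  "gate_graph \<Gamma> = \<lparr>vertices = qubits \<Gamma>, edges = set (gates \<Gamma>)\<rparr>"

definition large_comp_qubits :: "circuit \<Rightarrow> nat set" where
  "large_comp_qubits \<Gamma> = {q. \<exists>K \<in> conn_comps (gate_graph \<Gamma>). card K \<ge> 3 \<and> q \<in> K}"

definition fixing_pattern :: "circuit \<Rightarrow> nat set set" where
  "fixing_pattern \<Gamma> =
     {{q} | q. q \<in> large_comp_qubits \<Gamma>}
     \<union> {K \<in> conn_comps (gate_graph \<Gamma>). card K = 2}
     \<union> {I. I = isolated_verts (gate_graph \<Gamma>) \<and> I \<noteq> {}}"

text \<open>\<open>H\<close> is the coupling graph, and \<open>\<tau>\<close> maps locations (vertices of \<open>H\<close>) to qubits.\<close>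

definition B_set :: "nat ugraph \<Rightarrow> circuit \<Rightarrow> (nat \<Rightarrow> nat) \<Rightarrow> (nat \<Rightarrow> nat) set" where
  "B_set H \<Gamma> \<tau> = {b \<in> graph_aut H. \<forall>S \<in> fixing_pattern \<Gamma>. b ` (inv \<tau> ` S) = inv \<tau> ` S}"

end

theory Submission
  imports Defs "HOL-Number_Theory.Cong"
begin

text \<open>
  Every qubit in a large component forms a singleton part of the fixing pattern, so an element of
  \<open>B_set\<close> fixes its location. Since \<open>\<tau>\<close> is a bijection, \<open>c \<ge> 3\<close> yields three distinct fixed
  vertices of the cycle, and it remains to see that an automorphism of \<open>C_N\<close> with three fixed
  points is the identity.

  The automorphisms of the cycle are rotations and reflections: modulo \<open>N\<close>, an automorphism has
  the form \<open>i \<mapsto> d + s * i\<close> with \<open>s = 1\<close> or \<open>s = -1\<close> (lemma \<open>cycle_aut_affine\<close>), because once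
  the direction of the first step is known, injectivity forces every later step to go the same
  way. A rotation with a fixed point has \<open>d = 0\<close> modulo \<open>N\<close> and is therefore the identity. For a
  reflection, fixed points \<open>i\<close> solve \<open>2 * i = d\<close> modulo \<open>N\<close>, and this has at most two solutions
  in a set of representatives.
\<close>

lemma cong_imp_eq_of_range:
  fixes x y N :: nat
  assumes "[int x = int y] (mod int N)" "x \<in> {1..N}" "y \<in> {1..N}"
  shows "x = y"
proof -
  have "\<bar>int x - int y\<bar> < int N" using assms(2,3) by auto
  moreover have "int N dvd int x - int y" using assms(1) by (simp add: cong_iff_dvd_diff)
  ultimately show ?thesis using dvd_imp_le_int[of "int x - int y" "int N"] by fastforce
qed

lemma cycle_edge_cong:
  assumes "{x, y} \<in> edges (cycle_graph N)"
  shows "[int y = int x + 1] (mod int N) \<or> [int y = int x - 1] (mod int N)"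
proof -
  consider i where "{x, y} = {i, i + 1}" | "{x, y} = {N, 1}"
    using assms by (auto simp: cycle_graph_def)
  then show ?thesis
    by cases (auto simp: doubleton_eq_iff cong_iff_dvd_diff)
qed

text \<open>The direction \<open>s\<close> is read off from the images of \<open>1\<close> and \<open>2\<close>; it cannot change later, since
  a reversal at \<open>i + 1\<close> would give \<open>i + 2\<close> the same image as \<open>i\<close>.\<close>

lemma cycle_aut_affine:
  assumes N: "N \<ge> 3" and b: "b \<in> graph_aut (cycle_graph N)"
  obtains s d :: int where "s = 1 \<or> s = -1"
    "\<And>i. i \<in> {1..N} \<Longrightarrow> [int (b i) = d + s * int i] (mod int N)"
proof -
  have perm: "b permutes {1..N}" using b by (simp add: graph_aut_def cycle_graph_def)
  have step: "[int (b (Suc i)) = int (b i) + 1] (mod int N)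
      \<or> [int (b (Suc i)) = int (b i) - 1] (mod int N)" if "1 \<le> i" "i < N" for i
  proof (rule cycle_edge_cong)
    have "{i, Suc i} \<in> edges (cycle_graph N)" using that by (auto simp: cycle_graph_def)
    then show "{b i, b (Suc i)} \<in> edges (cycle_graph N)"
      using b that by (auto simp: graph_aut_def cycle_graph_def)
  qed
  obtain s :: int where s: "s = 1 \<or> s = -1"
    and s1: "[int (b (Suc 1)) = int (b 1) + s] (mod int N)"
    using step[of 1] N by force
  have same: "[int (b (Suc i)) = int (b i) + s] (mod int N)" if "1 \<le> i" "i < N" for i
    using that
  proof (induction i rule: nat_induct_at_least)
    case base
    then show ?case using s1 by simp
  next
    case (Suc i)
    have prev: "[int (b (Suc i)) = int (b i) + s] (mod int N)" using Suc by simp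
    have "[int (b (Suc (Suc i))) = int (b (Suc i)) + s] (mod int N)
        \<or> [int (b (Suc (Suc i))) = int (b (Suc i)) - s] (mod int N)"
      using step[of "Suc i"] Suc s by auto
    moreover have False if "[int (b (Suc (Suc i))) = int (b (Suc i)) - s] (mod int N)"
    proof -
      have "[int (b (Suc (Suc i))) = int (b i)] (mod int N)"
        using cong_trans[OF that cong_diff[OF prev cong_refl[of s]]] by simp
      moreover have "b (Suc (Suc i)) \<in> {1..N}" "b i \<in> {1..N}"
        using permutes_in_image[OF perm] Suc by auto
      ultimately have "b (Suc (Suc i)) = b i" by (rule cong_imp_eq_of_range)
      then have "Suc (Suc i) = i" by (rule injD[OF permutes_inj[OF perm]])
      then show False by simp
    qed
    ultimately show ?case by blast
  qed
  have "[int (b i) = (int (b 1) - s) + s * int i] (mod int N)" if "1 \<le> i" "i \<le> N" for i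
    using that
  proof (induction i rule: nat_induct_at_least)
    case base
    then show ?case by simp
  next
    case (Suc i)
    then show ?case
      using cong_trans[OF same[of i] cong_add[OF Suc.IH cong_refl[of s]]]
      by (simp add: algebra_simps)
  qed
  then show ?thesis using that[OF s] by auto
qed

text \<open>Two distinct solutions in \<open>{1..N}\<close> differ by exactly \<open>N / 2\<close>, which three pairwise distinct
  numbers cannot do.\<close>

lemma double_cong_at_most_two:
  fixes d :: int and x y z N :: nat
  assumes "x \<in> {1..N}" "y \<in> {1..N}" "z \<in> {1..N}" "x \<noteq> y" "x \<noteq> z" "y \<noteq> z"
    and "[2 * int x = d] (mod int N)" "[2 * int y = d] (mod int N)" "[2 * int z = d] (mod int N)"
  shows False
proof -
  have half: "2 * \<bar>int u - int v\<bar> = int N"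
    if "u \<in> {1..N}" "v \<in> {1..N}" "u \<noteq> v"
      "[2 * int u = d] (mod int N)" "[2 * int v = d] (mod int N)" for u v
  proof -
    have "int N dvd 2 * int u - 2 * int v"
      using cong_trans[OF that(4) cong_sym[OF that(5)]] by (simp add: cong_iff_dvd_diff)
    then obtain k where k: "2 * (int u - int v) = int N * k"
      by (auto simp: dvd_def algebra_simps)
    have "\<bar>int N * k\<bar> < int N * 2" using that(1,2) unfolding k[symmetric] by auto
    then have "\<bar>k\<bar> < 2" by (simp add: abs_mult mult_less_cancel_left)
    moreover have "k \<noteq> 0" using k that(3) by auto
    ultimately have "k = 1 \<or> k = -1" by auto
    then show ?thesis using k by auto
  qed
  have "2 * \<bar>int x - int y\<bar> = int N" "2 * \<bar>int x - int z\<bar> = int N"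
    "2 * \<bar>int y - int z\<bar> = int N"
    using half assms by blast+
  moreover have "int N > 0" using assms(1) by simp
  ultimately show False by (auto simp: abs_if split: if_splits)
qed

lemma cycle_aut_three_fixed_points_imp_id:
  assumes N: "N \<ge> 3" and b: "b \<in> graph_aut (cycle_graph N)"
    and F: "F \<subseteq> {1..N}" "card F \<ge> 3" "\<And>x. x \<in> F \<Longrightarrow> b x = x"
  shows "b = id"
proof -
  have perm: "b permutes {1..N}" using b by (simp add: graph_aut_def cycle_graph_def)
  obtain T where "T \<subseteq> F" "card T = 3" using F(2) obtain_subset_with_card_n by metis
  then obtain x y z where xyz: "x \<in> F" "y \<in> F" "z \<in> F" "x \<noteq> y" "x \<noteq> z" "y \<noteq> z"
    by (auto simp: card_3_iff)
  obtain s d :: int where s: "s = 1 \<or> s = -1"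
    and aff: "\<And>i. i \<in> {1..N} \<Longrightarrow> [int (b i) = d + s * int i] (mod int N)"
    using cycle_aut_affine[OF N b] by blast
  have fixed: "[int i = d + s * int i] (mod int N)" if "i \<in> F" for i
    using aff[of i] F that by auto
  show ?thesis
  proof (cases "s = 1")
    case True
    have d: "[d = 0] (mod int N)"
      using fixed[OF xyz(1)] True by (simp add: cong_iff_dvd_diff)
    have "b i = i" if i: "i \<in> {1..N}" for i
    proof (rule cong_imp_eq_of_range)
      show "[int (b i) = int i] (mod int N)"
        using cong_trans[OF aff[OF i] cong_add[OF d cong_refl[of "s * int i"]]] True by simp
    qed (use i permutes_in_image[OF perm] in auto)
    then show ?thesis using permutes_not_in[OF perm] by fastforce
  next
    case False
    have "[2 * int i = d] (mod int N)" if "i \<in> F" for i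
      using cong_add[OF fixed[OF that] cong_refl[of "int i"]] False s by simp
    then show ?thesis using double_cong_at_most_two[of x N y z d] xyz F(1) by blast
  qed
qed

lemma large_comp_qubits_subset: "large_comp_qubits \<Gamma> \<subseteq> qubits \<Gamma>"
  by (auto simp: large_comp_qubits_def conn_comps_def quotient_def reach_rel_def gate_graph_def)

theorem theorem5p1:
  fixes n N c :: nat and \<Gamma> :: circuit
  assumes "N \<ge> 3" and "n = N"
    and "quantum_circuit n \<Gamma>"
    and "c = card (large_comp_qubits \<Gamma>)"
    and "c \<ge> 3"
  shows "\<forall>\<tau>. \<tau> permutes {1..n} \<longrightarrow> B_set (cycle_graph N) \<Gamma> \<tau> = {id}"
proof (intro allI impI)
  fix \<tau> :: "nat \<Rightarrow> nat"
  assume \<tau>: "\<tau> permutes {1..n}"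
  let ?L = "large_comp_qubits \<Gamma>"
  let ?F = "inv \<tau> ` ?L"
  have inv: "inv \<tau> permutes {1..N}" using permutes_inv[OF \<tau>] assms(2) by simp
  have F: "?F \<subseteq> {1..N}"
    using large_comp_qubits_subset[of \<Gamma>] assms(2,3) permutes_in_image[OF inv]
    by (auto simp: quantum_circuit_def)
  have card_F: "card ?F \<ge> 3"
    using assms(4,5) card_image[OF permutes_inj_on[OF inv]] by simp
  have "b = id" if b: "b \<in> B_set (cycle_graph N) \<Gamma> \<tau>" for b
  proof (rule cycle_aut_three_fixed_points_imp_id[OF assms(1) _ F card_F])
    show "b \<in> graph_aut (cycle_graph N)" using b by (simp add: B_set_def)
    fix x assume "x \<in> ?F"
    then obtain q where q: "q \<in> ?L" "x = inv \<tau> q" by blast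
    then have "{q} \<in> fixing_pattern \<Gamma>" by (auto simp: fixing_pattern_def)
    then have "b ` (inv \<tau> ` {q}) = inv \<tau> ` {q}" using b unfolding B_set_def by blast
    then show "b x = x" using q by simp
  qed
  moreover have "id \<in> B_set (cycle_graph N) \<Gamma> \<tau>"
    by (simp add: B_set_def graph_aut_def permutes_id)
  ultimately show "B_set (cycle_graph N) \<Gamma> \<tau> = {id}" by blast
qed

end
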